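(* Let $k$ be a composite positive integer. Then there exist at least two non-equivalent $(k^2+1,2,k,1)$-SEDFs in $\mathbb{Z}_{k^2+1}$.
   Context: For an additive group $G$ of order $n$, an $(n,m,k,\lambda)$-SEDF is a set of $m\ge2$ pairwise disjoint $k$-subsets $A_1,\ldots,A_m$ of $G$ such that for every $i$ the multiset $\{x-y: x\in A_i, y\in \bigcup_{j\neq i}A_j\}$ contains every non-zero element of $G$ exactly $\lambda$ times. Two $(n,m,k,\lambda)$-SEDFs $\{A_1,\ldots,A_m\}$ and $\{A'_1,\ldots,A'_m\}$ over $\mathbb{Z}_n$ are equivalent if there exist an automorphism $\alpha$ of $\mathbb{Z}_n$ (i.e. $x\mapsto ux$ for a unit $u$) and $c\in\mathbb{Z}_n$ such that, after suitable ordering of the sets, $A'_i=\alpha(A_i)+c$ for all $i$. *)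

theory Defs
  imports
    "HOL-Algebra.Elementary_Groups"
    "HOL-Computational_Algebra.Primes"
    "HOL-Library.Multiset"
    "HOL-Library.Disjoint_Sets"
begin

text \<open>
  Groups are HOL-Algebra groups, so the additive \<open>x - y\<close> is written
  \<open>x \<otimes> inv y\<close>.  The cyclic group \<open>\<int>\<^sub>n\<close> is
  \<^const>\<open>integer_mod_group\<close>: carrier \<open>{0..<int n}\<close> with addition modulo \<open>n\<close>.
\<close>

definition external_differences ::
  "('a, 'b) monoid_scheme \<Rightarrow> 'a set \<Rightarrow> 'a set \<Rightarrow> 'a multiset" where
  "external_differences G A B =
     image_mset (\<lambda>(x, y). x \<otimes>\<^bsub>G\<^esub> inv\<^bsub>G\<^esub> y) (mset_set (A \<times> B))"

text \<open>
  An SEDF is an unordered set of blocks, \<open>F = {A\<^sub>1, \<dots>, A\<^sub>m}\<close>; thus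
  \<open>\<Union>(F - {A\<^sub>i})\<close> is the union of the \<open>A\<^sub>j\<close> with \<open>j \<noteq> i\<close>.
\<close>

definition is_SEDF ::
  "('a, 'b) monoid_scheme \<Rightarrow> nat \<Rightarrow> nat \<Rightarrow> nat \<Rightarrow> nat \<Rightarrow> 'a set set \<Rightarrow> bool" where
  "is_SEDF G n m k l F \<longleftrightarrow>
     group G \<and> finite (carrier G) \<and> order G = n \<and>
     2 \<le> m \<and> finite F \<and> card F = m \<and> disjoint F \<and>
     (\<forall>A\<in>F. A \<subseteq> carrier G \<and> card A = k) \<and>
     (\<forall>A\<in>F. \<forall>g\<in>carrier G - {\<one>\<^bsub>G\<^esub>}.
        count (external_differences G A (\<Union>(F - {A}))) g = l)"

text \<open>
  The bijection \<open>\<sigma>\<close> is the reordering of the blocks.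
\<close>

definition SEDF_equivalent ::
  "('a, 'b) monoid_scheme \<Rightarrow> 'a set set \<Rightarrow> 'a set set \<Rightarrow> bool" where
  "SEDF_equivalent G F F' \<longleftrightarrow>
     (\<exists>\<alpha>\<in>iso G G. \<exists>c\<in>carrier G. \<exists>\<sigma>.
        bij_betw \<sigma> F F' \<and> (\<forall>A\<in>F. \<sigma> A = (\<lambda>x. \<alpha> x \<otimes>\<^bsub>G\<^esub> c) ` A))"

end

theory Submission
  imports Defs
begin

text \<open>
  For \<open>k = a b\<close>, mixed radix expansion of \<open>{0..<k\<^sup>2}\<close> with radices \<open>a, b, b, a\<close> gives two blocks: the
  digits of weight \<open>1\<close> and \<open>k\<close> (reflected) form the lower one, those of weight \<open>a\<close> and \<open>k b\<close>
  the upper one, and their differences run through \<open>1, \<dots>, k\<^sup>2\<close> exactly once.  For \<open>b = 1\<close> both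
  blocks are arithmetic progressions, so some non-zero translation moves all but one of their
  elements inside the block, a property preserved by equivalence.  For \<open>a, b \<ge> 2\<close> the lower block is
  a two-dimensional grid in the lower half of \<open>\<int>\<^sub>n\<close>, and every non-zero translation moves at
  least two of its elements outside.
\<close>

section \<open>Two-block SEDFs from integer difference covers\<close>

lemma count_external_differences:
  assumes "finite A" "finite B"
  shows "count (external_differences G A B) g =
    card {p \<in> A \<times> B. fst p \<otimes>\<^bsub>G\<^esub> inv\<^bsub>G\<^esub> snd p = g}"
proof -
  have "{p. p \<in> A \<times> B \<and> g = fst p \<otimes>\<^bsub>G\<^esub> inv\<^bsub>G\<^esub> snd p} = {p \<in> A \<times> B. fst p \<otimes>\<^bsub>G\<^esub> inv\<^bsub>G\<^esub> snd p = g}"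
    by auto
  then show ?thesis
    using assms
    by (simp add: external_differences_def count_image_mset' case_prod_unfold)
qed

lemma diff_integer_mod_group:
  assumes "x \<in> carrier (integer_mod_group n)" "y \<in> carrier (integer_mod_group n)"
  shows "x \<otimes>\<^bsub>integer_mod_group n\<^esub> inv\<^bsub>integer_mod_group n\<^esub> y = (x - y) mod int n"
  using assms by (simp add: mod_add_right_eq)

lemma card_fibre_inj_on:
  assumes "inj_on f S" "y \<in> f ` S"
  shows "card {x \<in> S. f x = y} = 1"
proof -
  obtain x where "x \<in> S" "y = f x" using assms by blast
  then have "{x \<in> S. f x = y} = {x}" using assms(1) by (auto dest: inj_onD)
  then show ?thesis by simp
qed

text \<open>At most \<open>k * k\<close> pairs must produce \<open>k * k\<close> distinct
  differences, so both blocks have exactly \<open>k\<close> elements and each difference arises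
  once. All integer differences lie strictly between 0 and \<open>n\<close>, which makes the blocks
  disjoint and lets the count pass unchanged to residues modulo \<open>n\<close>.\<close>

lemma SEDF_of_difference_cover:
  fixes P Q :: "int set" and k :: nat
  defines "n \<equiv> k\<^sup>2 + 1"
  assumes PQ: "P \<subseteq> {0..<int n}" "Q \<subseteq> {0..<int n}"
    and cards: "card P \<le> k" "card Q \<le> k" and "0 < k"
    and cover: "(\<lambda>p. fst p - snd p) ` (P \<times> Q) = {1..int k ^ 2}"
  shows "is_SEDF (integer_mod_group n) n 2 k 1 {P, Q}"
proof -
  let ?G = "integer_mod_group n" and ?d = "\<lambda>p::int \<times> int. fst p - snd p"
  have fin: "finite P" "finite Q" using PQ finite_subset by blast+
  have carrier: "carrier ?G = {0..<int n}" by (simp add: carrier_integer_mod_group n_def)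
  have card_interval: "card {1..int k ^ 2} = k * k"
    by (simp add: nat_power_eq power2_eq_square nat_mult_distrib)
  have le: "k * k \<le> card P * card Q"
    using card_image_le[of "P \<times> Q" ?d] fin cover card_interval by (simp add: card_cartesian_product)
  \<comment> \<open>Neither factor exceeds \<open>k\<close>, yet the product reaches
    \<open>k * k\<close>, so both equal \<open>k\<close>; positivity of \<open>k\<close> permits
    cancellation.\<close>
  have card_P: "card P = k"
    using le cards mult_le_mono[of "card P" "card P" "card Q" k] \<open>0 < k\<close>
    by (metis le_antisym le_trans mult_le_cancel2 le_refl)
  have card_Q: "card Q = k"
    using le card_P cards \<open>0 < k\<close> by simp
  have inj: "inj_on ?d (P \<times> Q)"
    using fin cover card_interval card_P card_Q
    by (intro eq_card_imp_inj_on) (auto simp: card_cartesian_product)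
  have d_range: "1 \<le> x - y \<and> x - y < int n" if "x \<in> P" "y \<in> Q" for x y
  proof -
    have "?d (x, y) \<in> {1..int k ^ 2}" using that cover by blast
    then show ?thesis by (simp add: n_def)
  qed
  have disj: "P \<inter> Q = {}" using d_range by fastforce
  have "P \<noteq> Q" using disj card_P \<open>0 < k\<close> by auto
  have count_PQ: "count (external_differences ?G P Q) g = 1" if "g \<in> {1..<int n}" for g
  proof -
    have "x \<otimes>\<^bsub>?G\<^esub> inv\<^bsub>?G\<^esub> y = x - y" if "x \<in> P" "y \<in> Q" for x y
      using that PQ d_range[OF that] by (subst diff_integer_mod_group) (auto simp: carrier)
    then have "{p \<in> P \<times> Q. fst p \<otimes>\<^bsub>?G\<^esub> inv\<^bsub>?G\<^esub> snd p = g} = {p \<in> P \<times> Q. ?d p = g}"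
      by auto
    moreover have "g \<in> ?d ` (P \<times> Q)" using that by (simp add: cover n_def)
    ultimately show ?thesis
      by (simp only: count_external_differences[OF fin] card_fibre_inj_on[OF inj])
  qed
  \<comment> \<open>Negating a difference modulo \<open>n\<close> sends it to its complement in
    \<open>n\<close>. Swapping the pairs thus reduces the count of \<open>g\<close> to that of
    \<open>int n - g\<close> for \<open>P\<close> and \<open>Q\<close>.\<close>
  have count_QP: "count (external_differences ?G Q P) g = 1" if "g \<in> {1..<int n}" for g
  proof -
    have "y \<otimes>\<^bsub>?G\<^esub> inv\<^bsub>?G\<^esub> x = int n - (x - y)" if "x \<in> P" "y \<in> Q" for x y
    proof -
      have "(y - x) mod int n = (y - x + int n) mod int n" by simp
      also have "\<dots> = int n - (x - y)"
        using d_range[OF that] by (subst mod_pos_pos_trivial) auto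
      finally show ?thesis
        using that PQ by (subst diff_integer_mod_group) (auto simp: carrier)
    qed
    then have eq: "{p \<in> Q \<times> P. fst p \<otimes>\<^bsub>?G\<^esub> inv\<^bsub>?G\<^esub> snd p = g}
        = prod.swap ` {p \<in> P \<times> Q. ?d p = int n - g}"
      by (force simp: image_iff)
    have "int n - g \<in> ?d ` (P \<times> Q)" using that by (simp add: cover n_def)
    then have "card {p \<in> P \<times> Q. ?d p = int n - g} = 1"
      by (rule card_fibre_inj_on[OF inj])
    then show ?thesis
      by (simp only: count_external_differences[OF fin(2,1)] eq card_image inj_swap)
  qed
  have "{P, Q} - {P} = {Q}" "{P, Q} - {Q} = {P}" using \<open>P \<noteq> Q\<close> by auto
  moreover have "carrier ?G - {\<one>\<^bsub>?G\<^esub>} = {1..<int n}" by (auto simp: carrier)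
  moreover have "disjoint {P, Q}" using disj by (auto simp: disjoint_def)
  ultimately show ?thesis
    using count_PQ count_QP \<open>P \<noteq> Q\<close> PQ card_P card_Q
    by (auto simp: is_SEDF_def carrier order_def)
qed

section \<open>The mixed radix blocks\<close>

definition lower_block :: "int \<Rightarrow> int \<Rightarrow> int set" where
  "lower_block a b = (\<lambda>(i, j). i + a * b * j) ` ({0..<a} \<times> {0..<b})"

text \<open>The offset \<open>a + a * b * (b - 1)\<close> is one more than the largest element of
  \<open>lower_block a b\<close>, so the smallest difference is 1.\<close>

definition upper_block :: "int \<Rightarrow> int \<Rightarrow> int set" where
  "upper_block a b =
     (\<lambda>(s, t). a + a * b * (b - 1) + a * s + a * b * b * t) ` ({0..<b} \<times> {0..<a})"

lemma lower_block_bounds: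
  assumes "x \<in> lower_block a b" "0 < a" "0 < b"
  shows "0 \<le> x" "x \<le> a - 1 + a * b * (b - 1)"
proof -
  obtain i j where x: "x = i + a * b * j" and ij: "0 \<le> i" "i \<le> a - 1" "0 \<le> j" "j \<le> b - 1"
    using assms(1) by (auto simp: lower_block_def)
  have "0 \<le> a * b * j" "a * b * j \<le> a * b * (b - 1)"
    using ij assms by (auto intro!: mult_left_mono)
  then show "0 \<le> x" "x \<le> a - 1 + a * b * (b - 1)" using x ij by linarith+
qed

lemma upper_block_bounds:
  assumes "x \<in> upper_block a b" "0 < a" "0 < b"
  shows "0 \<le> x" "x \<le> (a * b)\<^sup>2"
proof -
  obtain s t where x: "x = a + a * b * (b - 1) + a * s + a * b * b * t"
    and st: "0 \<le> s" "s \<le> b - 1" "0 \<le> t" "t \<le> a - 1"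
    using assms(1) by (auto simp: upper_block_def)
  have "0 \<le> a * s" "a * s \<le> a * (b - 1)" "0 \<le> a * b * b * t" "a * b * b * t \<le> a * b * b * (a - 1)"
    "0 \<le> a * b * (b - 1)"
    using st assms by (auto intro!: mult_left_mono)
  then show "0 \<le> x" using x assms by linarith
  \<comment> \<open>The right-hand side is the value at the top digits \<open>s = b - 1\<close> and
    \<open>t = a - 1\<close>.\<close>
  have "(a * b)\<^sup>2 = a + a * b * (b - 1) + a * (b - 1) + a * b * b * (a - 1)"
    by (simp add: algebra_simps power2_eq_square)
  with x \<open>a * s \<le> a * (b - 1)\<close> \<open>a * b * b * t \<le> a * b * b * (a - 1)\<close>
  show "x \<le> (a * b)\<^sup>2" by linarith
qed

text \<open>Every \<open>g\<close> in the range is 1 plus a number \<open>w\<close> below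
  \<open>(a * b)\<^sup>2\<close>. The mixed radix digits of \<open>w\<close> supply an explicit pair
  with difference \<open>g\<close>.\<close>

lemma block_differences:
  assumes "0 < a" "0 < b"
  shows "(\<lambda>p. fst p - snd p) ` (upper_block a b \<times> lower_block a b) = {1..(a * b)\<^sup>2}"
    (is "?D = _")
proof
  show "?D \<subseteq> {1..(a * b)\<^sup>2}"
  proof clarsimp
    fix x y assume xy: "x \<in> upper_block a b" "y \<in> lower_block a b"
    obtain s t where x: "x = a + a * b * (b - 1) + a * s + a * b * b * t" "0 \<le> s" "0 \<le> t"
      using xy(1) by (auto simp: upper_block_def)
    have "0 \<le> a * s" "0 \<le> a * b * b * t" using x assms by auto
    then show "1 \<le> x - y \<and> x - y \<le> (a * b)\<^sup>2"
      using x lower_block_bounds[OF xy(2) assms] upper_block_bounds[OF xy(1) assms] by auto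
  qed
next
  show "{1..(a * b)\<^sup>2} \<subseteq> ?D"
  proof
    fix g assume g: "g \<in> {1..(a * b)\<^sup>2}"
    define w where "w = g - 1"
    \<comment> \<open>The digits of \<open>w\<close> are \<open>w mod a\<close>,
      \<open>q mod b\<close>, \<open>r mod b\<close> and \<open>u\<close>, of weights 1,
      \<open>a\<close>, \<open>a * b\<close> and \<open>a * b * b\<close>.\<close>
    define q r u where "q = w div a" and "r = q div b" and "u = r div b"
    have w: "0 \<le> w" "w < (a * b)\<^sup>2" using g by (auto simp: w_def)
    have u: "u = w div (a * b * b)"
      using assms by (simp add: u_def r_def q_def zdiv_zmult2_eq)
    have "w < a * (a * b * b)" using w by (simp add: power2_eq_square algebra_simps)
    moreover have "a * b * b * u \<le> w"
    proof -
      have "0 \<le> w mod (a * b * b)" using assms by simp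
      then show ?thesis unfolding u using mult_div_mod_eq[of "a * b * b" w] by linarith
    qed
    ultimately have "u * (a * b * b) < a * (a * b * b)" by (simp add: algebra_simps)
    then have "u < a" using assms by (simp add: mult_less_cancel_right)
    have "0 \<le> u" unfolding u using w assms by (simp add: pos_imp_zdiv_nonneg_iff)
    have dw: "w = a * q + w mod a" and dq: "q = b * r + q mod b" and dr: "r = b * u + r mod b"
      by (simp_all add: q_def r_def u_def)
    \<comment> \<open>The lower block receives complemented digits, so subtracting \<open>y\<close>
      adds the original ones. What remains of the offset is \<open>a - (a - 1) = 1\<close>, the
      difference between \<open>g\<close> and \<open>w\<close>.\<close>
    define x where "x = a + a * b * (b - 1) + a * (q mod b) + a * b * b * u"
    define y where "y = (a - 1 - w mod a) + a * b * (b - 1 - r mod b)"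
    have "w = a * (b * (b * u + r mod b) + q mod b) + w mod a"
      using dw dq dr by simp
    then have "g = x - y" unfolding x_def y_def w_def by (simp add: algebra_simps)
    moreover have "x \<in> upper_block a b"
      unfolding upper_block_def x_def using assms \<open>0 \<le> u\<close> \<open>u < a\<close>
      by (intro image_eqI[of _ _ "(q mod b, u)"]) auto
    moreover have "y \<in> lower_block a b"
    proof -
      have "a - 1 - w mod a \<in> {0..<a}"
        unfolding atLeastLessThan_iff using pos_mod_bound[of a w] pos_mod_sign[of a w] assms
        by linarith
      moreover have "b - 1 - r mod b \<in> {0..<b}"
        unfolding atLeastLessThan_iff using pos_mod_bound[of b r] pos_mod_sign[of b r] assms
        by linarith
      ultimately show ?thesis
        unfolding lower_block_def y_def
        by (intro image_eqI[of _ _ "(a - 1 - w mod a, b - 1 - r mod b)"]) simp_all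
    qed
    ultimately show "g \<in> ?D" by (auto intro!: image_eqI[of _ _ "(x, y)"])
  qed
qed

lemma SEDF_blocks:
  fixes a b :: nat
  assumes "0 < a" "0 < b"
  shows "is_SEDF (integer_mod_group ((a * b)\<^sup>2 + 1)) ((a * b)\<^sup>2 + 1) 2 (a * b) 1
    {upper_block (int a) (int b), lower_block (int a) (int b)}"
proof (rule SEDF_of_difference_cover)
  show "upper_block (int a) (int b) \<subseteq> {0..<int ((a * b)\<^sup>2 + 1)}"
    using upper_block_bounds[of _ "int a" "int b"] assms by fastforce
  show "lower_block (int a) (int b) \<subseteq> {0..<int ((a * b)\<^sup>2 + 1)}"
  proof
    fix y assume y: "y \<in> lower_block (int a) (int b)"
    \<comment> \<open>The upper element with both digits 0 exceeds the whole lower block, so the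
      bound for the upper block carries over.\<close>
    have "(0::int) \<in> {0..<int b}" "(0::int) \<in> {0..<int a}" using assms by auto
    then have "int a + int a * int b * (int b - 1) \<in> upper_block (int a) (int b)"
      unfolding upper_block_def by (intro image_eqI[of _ _ "(0, 0)"]) auto
    from upper_block_bounds(2)[OF this] lower_block_bounds[OF y] assms
    show "y \<in> {0..<int ((a * b)\<^sup>2 + 1)}" by auto
  qed
  show "card (upper_block (int a) (int b)) \<le> a * b" "card (lower_block (int a) (int b)) \<le> a * b"
    unfolding upper_block_def lower_block_def
    by (rule order.trans[OF card_image_le]; simp add: card_cartesian_product)+
  show "0 < a * b" using assms by simp
  show "(\<lambda>p. fst p - snd p) ` (upper_block (int a) (int b) \<times> lower_block (int a) (int b)) = {1..(int (a * b))\<^sup>2}"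
    using block_differences[of "int a" "int b"] assms by simp
qed

section \<open>An invariant of equivalence\<close>

text \<open>Some non-trivial translation moves at most one element out of \<open>X\<close>; as
  \<open>z\<close> may lie outside \<open>X\<close>, sets mapped into themselves are
  included.\<close>

definition almost_periodic :: "('a, 'b) monoid_scheme \<Rightarrow> 'a set \<Rightarrow> bool" where
  "almost_periodic G X \<longleftrightarrow>
     (\<exists>d\<in>carrier G - {\<one>\<^bsub>G\<^esub>}. \<exists>z. \<forall>x\<in>X. x \<noteq> z \<longrightarrow> x \<otimes>\<^bsub>G\<^esub> d \<in> X)"

text \<open>Translation by \<open>d\<close> turns into translation by \<open>\<alpha> d\<close>,
  which is non-trivial by injectivity, and the exceptional element becomes the image of
  \<open>z\<close>.\<close>

lemma almost_periodic_affine_image: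
  assumes "comm_group G" "X \<subseteq> carrier G" "almost_periodic G X" "\<alpha> \<in> iso G G" "c \<in> carrier G"
  shows "almost_periodic G ((\<lambda>x. \<alpha> x \<otimes>\<^bsub>G\<^esub> c) ` X)"
proof -
  interpret comm_group G by fact
  have hom: "\<alpha> \<in> hom G G" and bij: "bij_betw \<alpha> (carrier G) (carrier G)"
    using assms(4) by (auto simp: iso_def)
  obtain d z where d: "d \<in> carrier G" "d \<noteq> \<one>\<^bsub>G\<^esub>" and z: "\<And>x. x \<in> X \<Longrightarrow> x \<noteq> z \<Longrightarrow> x \<otimes>\<^bsub>G\<^esub> d \<in> X"
    using assms(3) by (auto simp: almost_periodic_def)
  have "\<alpha> d \<noteq> \<one>\<^bsub>G\<^esub>"
    using d bij hom_one[OF hom is_group is_group] by (metis bij_betw_imp_inj_on inj_onD one_closed)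
  moreover have "\<alpha> d \<in> carrier G" using d hom by (simp add: hom_in_carrier)
  moreover have "\<alpha> x \<otimes>\<^bsub>G\<^esub> c \<otimes>\<^bsub>G\<^esub> \<alpha> d \<in> (\<lambda>x. \<alpha> x \<otimes>\<^bsub>G\<^esub> c) ` X"
    if "x \<in> X" "\<alpha> x \<otimes>\<^bsub>G\<^esub> c \<noteq> \<alpha> z \<otimes>\<^bsub>G\<^esub> c" for x
  proof -
    have "x \<in> carrier G" using that assms(2) by auto
    then have "\<alpha> x \<otimes>\<^bsub>G\<^esub> c \<otimes>\<^bsub>G\<^esub> \<alpha> d = \<alpha> (x \<otimes>\<^bsub>G\<^esub> d) \<otimes>\<^bsub>G\<^esub> c"
      using d hom assms(5) by (simp add: hom_mult hom_in_carrier m_ac)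
    moreover have "x \<otimes>\<^bsub>G\<^esub> d \<in> X" using z that by blast
    ultimately show ?thesis by blast
  qed
  ultimately show ?thesis unfolding almost_periodic_def by blast
qed

lemma almost_periodic_SEDF_equivalent:
  assumes "comm_group G" "SEDF_equivalent G F F'" "B \<in> F'"
    and "\<And>A. A \<in> F \<Longrightarrow> A \<subseteq> carrier G" "\<And>A. A \<in> F \<Longrightarrow> almost_periodic G A"
  shows "almost_periodic G B"
proof -
  obtain \<alpha> c \<sigma> where \<alpha>: "\<alpha> \<in> iso G G" and c: "c \<in> carrier G" and \<sigma>: "bij_betw \<sigma> F F'"
    and image: "\<forall>A\<in>F. \<sigma> A = (\<lambda>x. \<alpha> x \<otimes>\<^bsub>G\<^esub> c) ` A"
    using assms(2) by (auto simp: SEDF_equivalent_def)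
  have "B \<in> \<sigma> ` F" using \<sigma> assms(3) by (simp add: bij_betw_def)
  then obtain A where "A \<in> F" "B = \<sigma> A" by (rule imageE)
  then show ?thesis
    using almost_periodic_affine_image[OF assms(1) _ _ \<alpha> c] assms(4,5) image by simp
qed

section \<open>Progressions versus grids\<close>

text \<open>For \<open>b = 1\<close> the blocks are 0, ..., \<open>k - 1\<close> and the multiples
  \<open>k\<close>, \<open>2 * k\<close>, ..., \<open>k * k\<close>. Translating by the common
  difference, 1 or \<open>k\<close>, loses at most the last term.\<close>

lemma almost_periodic_progression_blocks:
  assumes "1 < k"
  shows "almost_periodic (integer_mod_group (k\<^sup>2 + 1)) (lower_block (int k) 1)"
    and "almost_periodic (integer_mod_group (k\<^sup>2 + 1)) (upper_block (int k) 1)"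
proof -
  let ?n = "k\<^sup>2 + 1"
  have carrier: "carrier (integer_mod_group ?n) = {0..<int ?n}"
    by (simp add: carrier_integer_mod_group)
  have n: "int ?n = int k * int k + 1" by (simp add: power2_eq_square)
  have le: "int k * 1 \<le> int k * int k" using assms by (intro mult_left_mono) auto
  have lower: "lower_block (int k) 1 = {0..<int k}"
  proof -
    have "{0..<1::int} = {0}" by auto
    then show ?thesis by (force simp: lower_block_def image_iff)
  qed
  have upper: "upper_block (int k) 1 = (\<lambda>t. int k * (t + 1)) ` {0..<int k}"
    by (force simp: upper_block_def image_iff algebra_simps)
  have "(x + 1) mod int ?n \<in> {0..<int k}" if "x \<in> {0..<int k}" "x \<noteq> int k - 1" for x
  proof -
    have "(x + 1) mod int ?n = x + 1"
      using that le by (intro mod_pos_pos_trivial) (unfold n atLeastLessThan_iff, linarith+)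
    then show ?thesis using that by auto
  qed
  then show "almost_periodic (integer_mod_group ?n) (lower_block (int k) 1)"
    unfolding almost_periodic_def lower using assms
    by (intro bexI[of _ 1] exI[of _ "int k - 1"]) (auto simp: carrier)
  have "(int k * (t + 1) + int k) mod int ?n \<in> upper_block (int k) 1"
    if "t \<in> {0..<int k}" "int k * (t + 1) \<noteq> int k * int k" for t
  proof -
    have t: "0 \<le> t" "t + 1 < int k" using that assms by (auto simp: less_le)
    then have "int k * (t + 2) \<le> int k * int k" by (intro mult_left_mono) auto
    then have "(int k * (t + 1) + int k) mod int ?n = int k * ((t + 1) + 1)"
      using t by (subst mod_pos_pos_trivial) (auto simp: algebra_simps power2_eq_square)
    then show ?thesis using t unfolding upper by auto
  qed
  moreover have "int k \<in> carrier (integer_mod_group ?n)" unfolding carrier n using le by auto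
  ultimately show "almost_periodic (integer_mod_group ?n) (upper_block (int k) 1)"
    unfolding almost_periodic_def using assms \<open>int k \<in> carrier (integer_mod_group ?n)\<close>
    by (intro bexI[of _ "int k"] exI[of _ "int k * int k"]) (auto simp: upper)
qed

text \<open>The block lies in an interval from 0 to \<open>M\<close> shorter than half of
  \<open>n\<close>. A translation by at most \<open>n / 2\<close> expels \<open>M\<close> and a
  second element near the top; a larger one acts as a backward shift and expels 0 and a second
  element near the bottom. Only the shifts by 1 and -1 require a look at the gaps between rows of
  the grid.\<close>

lemma not_almost_periodic_lower_block:
  fixes a b :: nat
  assumes "1 < a" "1 < b"
  shows "\<not> almost_periodic (integer_mod_group ((a * b)\<^sup>2 + 1)) (lower_block (int a) (int b))"
proof
  let ?n = "(a * b)\<^sup>2 + 1" and ?A = "lower_block (int a) (int b)"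
  define k where "k = int a * int b"
  define M where "M = int a - 1 + k * (int b - 1)"
  have n: "int ?n = k * k + 1" by (simp add: k_def power2_eq_square)
  have "2 * int b \<le> k" "2 * int a \<le> k" using assms by (simp_all add: k_def)
  then have k: "int a < k" "1 < k" using assms by auto
  have "k * (2 * int b) \<le> k * k" using \<open>2 * int b \<le> k\<close> k by (intro mult_left_mono) auto
  \<comment> \<open>Since \<open>2 * int b \<le> k\<close> and \<open>2 * int a \<le> k\<close>, the
    value \<open>2 * M\<close> is at most \<open>k * k - k - 2\<close>.\<close>
  then have M: "2 * M < int ?n" unfolding n M_def using \<open>2 * int a \<le> k\<close> by (simp add: algebra_simps)
  have bounds: "0 \<le> x" "x \<le> M" if "x \<in> ?A" for x
    using lower_block_bounds[OF that] assms by (simp_all add: M_def k_def)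
  \<comment> \<open>Each row of the grid occupies only residues below \<open>int a\<close> modulo
    \<open>k\<close>, and \<open>int a < k\<close> leaves a gap after every row.\<close>
  have residue: "x mod k < int a" if x: "x \<in> ?A" for x
  proof -
    obtain i j where "x = i + k * j" "0 \<le> i" "i < int a"
      using x by (auto simp: lower_block_def k_def)
    then show ?thesis using zmod_le_nonneg_dividend[of i k] by simp
  qed
  have mem: "i + k * j \<in> ?A" if "0 \<le> i" "i < int a" "0 \<le> j" "j < int b" for i j
    using that unfolding lower_block_def k_def by (intro image_eqI[of _ _ "(i, j)"]) auto
  have low: "0 \<in> ?A" "1 \<in> ?A" "k \<in> ?A"
    using mem[of 0 0] mem[of 1 0] mem[of 0 1] assms by auto
  have high: "M \<in> ?A" "M - 1 \<in> ?A" "M - k \<in> ?A"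
    using mem[of "int a - 1" "int b - 1"] mem[of "int a - 2" "int b - 1"]
      mem[of "int a - 1" "int b - 2"] assms by (auto simp: M_def algebra_simps)
  have gap_low: "k - 1 \<notin> ?A"
  proof -
    have "(k - 1) mod k = k - 1" using k by (intro mod_pos_pos_trivial) linarith+
    then show ?thesis using residue[of "k - 1"] k by linarith
  qed
  \<comment> \<open>This is the successor of \<open>M - k\<close>, the end of the last row but one;
    its residue is exactly \<open>int a\<close>.\<close>
  have gap_high: "M - k + 1 \<notin> ?A"
  proof -
    have "M - k + 1 = int a + (int b - 2) * k" by (simp add: M_def algebra_simps)
    then have "(M - k + 1) mod k = int a" using k by (simp del: of_nat_mult)
    then show ?thesis using residue by force
  qed
  have carrier: "carrier (integer_mod_group ?n) = {0..<int ?n}"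
    by (simp add: carrier_integer_mod_group)
  assume "almost_periodic (integer_mod_group ?n) ?A"
  then obtain d z where d_nonzero: "d \<in> {0..<int ?n} - {0}"
    and z: "\<And>x. x \<in> ?A \<Longrightarrow> x \<noteq> z \<Longrightarrow> (x + d) mod int ?n \<in> ?A"
    unfolding almost_periodic_def carrier mult_integer_mod_group one_integer_mod_group by blast
  have d: "0 < d" "d < int ?n" using d_nonzero by auto
  have z': "y = z" if "y \<in> ?A" "(y + d) mod int ?n \<notin> ?A" for y
    using z that by blast
  show False
  proof (cases "2 * d \<le> int ?n")
    case True
    \<comment> \<open>There is no wrap-around: \<open>2 * M\<close> is less than \<open>n\<close>
      and \<open>2 * d\<close> at most \<open>n\<close>, so \<open>M + d\<close> stays below
      \<open>n\<close>.\<close>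
    have eq: "(x + d) mod int ?n = x + d" if "x \<in> ?A" for x
      using bounds[OF that] M True d by (intro mod_pos_pos_trivial) linarith+
    have "M = z" using z'[OF high(1)] eq[OF high(1)] bounds[of "M + d"] d by auto
    moreover have "M - 1 = z" if "d \<noteq> 1"
      using z'[OF high(2)] eq[OF high(2)] bounds[of "M - 1 + d"] d that by auto
    \<comment> \<open>The shift by 1 keeps \<open>M - 1\<close> inside, so the second escaping
      element is the end of the preceding row.\<close>
    moreover have "M - k = z" if "d = 1"
      using z'[OF high(3)] eq[OF high(3)] gap_high that by auto
    ultimately show False using k by fastforce
  next
    case False
    then have "M < d" using M by linarith
    then have "0 = z" using z'[OF low(1)] bounds[of d] d by auto
    moreover have "1 = z" if "d \<noteq> int ?n - 1"
    proof -
      have "(1 + d) mod int ?n = 1 + d" using d that by (intro mod_pos_pos_trivial) linarith+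
      then show ?thesis using z'[OF low(2)] bounds[of "1 + d"] \<open>M < d\<close> by auto
    qed
    \<comment> \<open>Here \<open>d\<close> acts as -1 and sends 1 to 0, so the second escaping
      element is \<open>k\<close>, the start of the next row, which lands in the gap at
      \<open>k - 1\<close>.\<close>
    moreover have "k = z" if "d = int ?n - 1"
    proof -
      have "k * 1 \<le> k * k" using k by (intro mult_left_mono) auto
      then have "(k - 1) mod int ?n = k - 1" using k n by (intro mod_pos_pos_trivial) linarith+
      moreover have "(k + d) mod int ?n = (k - 1) mod int ?n"
        using that by (metis add_diff_eq diff_add_eq mod_add_self2)
      ultimately show ?thesis using z'[OF low(3)] gap_low by auto
    qed
    ultimately show False using k by fastforce
  qed
qed

theorem theorem5p5:
  fixes k :: nat
  assumes "1 < k" and "\<not> prime k"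
  shows "\<exists>F F'. is_SEDF (integer_mod_group (k^2 + 1)) (k^2 + 1) 2 k 1 F \<and>
                is_SEDF (integer_mod_group (k^2 + 1)) (k^2 + 1) 2 k 1 F' \<and>
                \<not> SEDF_equivalent (integer_mod_group (k^2 + 1)) F F'"
proof -
  let ?G = "integer_mod_group (k\<^sup>2 + 1)"
  obtain a where "a dvd k" "a \<noteq> 1" "a \<noteq> k" using assms by (auto simp: prime_nat_iff)
  then obtain b where k: "k = a * b" by blast
  have a: "1 < a" and b: "1 < b"
    using assms(1) k \<open>a \<noteq> 1\<close> \<open>a \<noteq> k\<close>
    by (metis less_one linorder_neqE_nat mult_0 mult_0_right mult_1_right)+
  \<comment> \<open>The same construction is applied to the trivial factorization
    \<open>k * 1\<close> and to the proper one \<open>a * b\<close>.\<close>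
  define F where "F = {upper_block (int k) 1, lower_block (int k) 1}"
  define F' where "F' = {upper_block (int a) (int b), lower_block (int a) (int b)}"
  have F: "is_SEDF ?G (k\<^sup>2 + 1) 2 k 1 F"
    using SEDF_blocks[of k 1] assms(1) by (simp add: F_def)
  have F': "is_SEDF ?G (k\<^sup>2 + 1) 2 k 1 F'"
    using SEDF_blocks[of a b] a b by (simp add: F'_def k)
  have "\<not> SEDF_equivalent ?G F F'"
  proof
    assume "SEDF_equivalent ?G F F'"
    moreover have "\<And>A. A \<in> F \<Longrightarrow> A \<subseteq> carrier ?G"
      using F by (simp add: is_SEDF_def)
    moreover have "\<And>A. A \<in> F \<Longrightarrow> almost_periodic ?G A"
      using almost_periodic_progression_blocks[OF assms(1)] by (auto simp: F_def)
    moreover have "lower_block (int a) (int b) \<in> F'" by (simp add: F'_def)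
    ultimately have "almost_periodic ?G (lower_block (int a) (int b))"
      using almost_periodic_SEDF_equivalent[OF abelian_integer_mod_group] by blast
    then show False using not_almost_periodic_lower_block[OF a b] by (simp add: k)
  qed
  then show ?thesis using F F' by blast
qed

end
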